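(* Let $n$ be a positive integer and let $D_n$ be a maximal Diophantine graph of order $n$ with Diophantine labelling $f$. Let $u,v$ be two vertices of $D_n$ such that $f(v)=tf(u)$ for some positive integer $t$ and $f(v)$ is not a prime power. Then $\deg(u)=\deg(v)$ if and only if for every prime number $p\mid t$, exactly one of the following holds: $\acute{v}_p(n)\leq v_p(f(u))$, or $\acute{v}_p(n)>v_p(f(v))$.
   Context: All graphs are finite, simple and undirected, and $(a,b)$ denotes the greatest common divisor of $a$ and $b$. A graph $G=(V,E)$ of order $n$ is a Diophantine graph if there is a bijection $f:V\to\{1,2,\dots,n\}$ (a Diophantine labelling) such that $(f(u),f(v))\mid n$ for all $uv\in E$. It is a maximal Diophantine graph, denoted $(D_n,f)$ or simply $D_n$, if adding any new edge turns it into a non-Diophantine graph; thus two distinct vertices $u,v$ of $D_n$ are adjacent if and only if $(f(u),f(v))\mid n$. For a prime $p$ and a positive integer $m$, $v_p(m)$ is the $p$-adic valuation of $m$, and $\acute{v}_p(m):=v_p(m)+1$. *)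

theory Defs
  imports
    "Graph_Theory.Pair_Digraph"
    "HOL-Number_Theory.Prime_Powers"
begin

(* A finite simple undirected graph is a pair_graph: a finite loopfree symmetric digraph
   without parallel arcs, each edge uv being the two arcs (u, v) and (v, u). The degree of
   a vertex is therefore its out-degree. *)

abbreviation vertex_degree :: "'a pair_pre_digraph \<Rightarrow> 'a \<Rightarrow> nat" where
  "vertex_degree G v \<equiv> out_degree (with_proj G) v"

definition add_edge :: "'a pair_pre_digraph \<Rightarrow> 'a \<Rightarrow> 'a \<Rightarrow> 'a pair_pre_digraph" where
  "add_edge G u v = G\<lparr>parcs := parcs G \<union> {(u, v), (v, u)}\<rparr>"

definition diophantine_labelling :: "'a pair_pre_digraph \<Rightarrow> ('a \<Rightarrow> nat) \<Rightarrow> bool" where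
  "diophantine_labelling G f \<longleftrightarrow>
     bij_betw f (pverts G) {1..card (pverts G)} \<and>
     (\<forall>u v. (u, v) \<in> parcs G \<longrightarrow> gcd (f u) (f v) dvd card (pverts G))"

definition diophantine_graph :: "'a pair_pre_digraph \<Rightarrow> bool" where
  "diophantine_graph G \<longleftrightarrow> pair_graph G \<and> (\<exists>f. diophantine_labelling G f)"

definition maximal_diophantine_graph :: "'a pair_pre_digraph \<Rightarrow> bool" where
  "maximal_diophantine_graph G \<longleftrightarrow>
     diophantine_graph G \<and>
     (\<forall>u\<in>pverts G. \<forall>v\<in>pverts G. u \<noteq> v \<and> (u, v) \<notin> parcs G \<longrightarrow>
        \<not> diophantine_graph (add_edge G u v))"

definition acute_val :: "nat \<Rightarrow> nat \<Rightarrow> nat" where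
  "acute_val p m = multiplicity p m + 1"

(* Maximality rules out every labelling of the enlarged graph, yet it pins down adjacency
   in terms of any given labelling. *)
lemma maximal_diophantine_graph_adjacent_iff:
  assumes "maximal_diophantine_graph G" and "diophantine_labelling G f"
    and "u \<in> pverts G" and "v \<in> pverts G" and "u \<noteq> v"
  shows "(u, v) \<in> parcs G \<longleftrightarrow> gcd (f u) (f v) dvd card (pverts G)"
proof
  assume "(u, v) \<in> parcs G"
  then show "gcd (f u) (f v) dvd card (pverts G)"
    using assms(2) by (simp add: diophantine_labelling_def)
next
  assume dvd: "gcd (f u) (f v) dvd card (pverts G)"
  show "(u, v) \<in> parcs G"
  proof (rule ccontr)
    assume nadj: "(u, v) \<notin> parcs G"
    from assms(1) interpret pair_graph G
      by (simp add: maximal_diophantine_graph_def diophantine_graph_def)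
    have sym: "sym (parcs G)"
      using arcs_symmetric by (auto intro: symI)
    have "pair_graph (add_edge G u v)"
    proof
      show "symmetric (with_proj (add_edge G u v))"
        using sym by (auto simp: add_edge_def symmetric_def sym_def)
    qed (use assms(3-5) pair_finite_verts pair_finite_arcs in_arcsD1 in_arcsD2 no_loops'
         in \<open>auto simp: add_edge_def\<close>)
    moreover have "diophantine_labelling (add_edge G u v) f"
      using assms(2) dvd by (auto simp: diophantine_labelling_def add_edge_def gcd.commute)
    ultimately show False
      using assms nadj
      by (auto simp: maximal_diophantine_graph_def diophantine_graph_def)
  qed
qed

end

theory Submission
  imports Defs
begin

text \<open>
  Write \<open>q\<^sub>p = p ^ acute_val p n\<close>, the least power of \<open>p\<close> not dividing \<open>n\<close>. Then \<open>gcd x y\<close>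
  divides \<open>n\<close> iff no \<open>q\<^sub>p\<close> divides both \<open>x\<close> and \<open>y\<close>, so the neighbours of a label \<open>x\<close> depend
  only on the set \<open>P(x)\<close> of primes \<open>p\<close> with \<open>q\<^sub>p dvd x\<close>, up to discarding \<open>x\<close> itself.
  The condition on the primes dividing \<open>t\<close> says \<open>P(f u) = P(f v)\<close>. If some \<open>p\<close> lies in
  \<open>P(f v)\<close> but not in \<open>P(f u)\<close>, then every neighbour of \<open>f v\<close>, with \<open>f u\<close> replaced by \<open>f v\<close> if
  need be, is a neighbour of \<open>f u\<close>. The label \<open>q\<^sub>p\<close> is a further neighbour of \<open>f u\<close>; it differs
  from \<open>f v\<close>, which is not a prime power, so the degree drops strictly.
\<close>

text \<open>The difference with \<open>{x}\<close> encodes the absence of loops: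
  \<open>gcd x x dvd n\<close> holds whenever \<open>x dvd n\<close>.\<close>

definition label_neighbours :: "nat \<Rightarrow> nat \<Rightarrow> nat set" where
  "label_neighbours n x = {y \<in> {1..n}. gcd x y dvd n} - {x}"

text \<open>Maximality makes adjacency a condition on labels and \<open>f\<close> is injective on
  vertices, so degrees can be counted among numbers.\<close>

lemma vertex_degree_eq_card_label_neighbours:
  assumes "maximal_diophantine_graph G" and lab: "diophantine_labelling G f"
    and w: "w \<in> pverts G"
  shows "vertex_degree G w = card (label_neighbours (card (pverts G)) (f w))"
proof -
  let ?n = "card (pverts G)"
  interpret pair_graph G
    using assms(1) by (simp add: maximal_diophantine_graph_def diophantine_graph_def)
  have bij: "bij_betw f (pverts G) {1..?n}"
    using lab by (simp add: diophantine_labelling_def)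
  let ?N = "{z \<in> pverts G. z \<noteq> w \<and> gcd (f w) (f z) dvd ?n}"
  have adj: "(w, z) \<in> parcs G \<longleftrightarrow> z \<in> ?N" for z
  proof (cases "z \<in> pverts G \<and> z \<noteq> w")
    case True
    then show ?thesis
      using maximal_diophantine_graph_adjacent_iff[OF assms, of z] by auto
  next
    case False
    then show ?thesis
      using in_arcsD2 no_loops' by blast
  qed
  have "out_arcs (with_proj G) w = Pair w ` ?N"
    unfolding out_arcs_def using adj by fastforce
  then have "vertex_degree G w = card ?N"
    by (simp add: out_degree_def card_image inj_on_def)
  moreover have "f ` ?N = label_neighbours ?n (f w)"
  proof -
    let ?M = "{z \<in> pverts G. gcd (f w) (f z) dvd ?n}"
    have inj: "inj_on f (pverts G)" and im: "f ` pverts G = {1..?n}"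
      using bij by (simp_all add: bij_betw_def)
    have "label_neighbours ?n (f w) = f ` ?M - f ` {w}"
      unfolding label_neighbours_def im[symmetric] by blast
    also have "\<dots> = f ` (?M - {w})"
      by (rule inj_on_image_set_diff[OF inj, symmetric]) (use w in auto)
    also have "?M - {w} = ?N"
      by blast
    finally show ?thesis ..
  qed
  moreover have "inj_on f ?N"
    using bij by (auto simp: bij_betw_def intro: inj_on_subset)
  ultimately show ?thesis
    using card_image[of f ?N] by simp
qed

lemma dvd_iff_acute_power_not_dvd:
  assumes "m > 0" and "n > 0"
  shows "m dvd n \<longleftrightarrow> (\<forall>p. prime p \<longrightarrow> \<not> p ^ acute_val p n dvd m)"
proof -
  have "p ^ acute_val p n dvd m \<longleftrightarrow> \<not> multiplicity p m \<le> multiplicity p n" if "prime p" for p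
    using that assms by (subst power_dvd_iff_le_multiplicity) (auto simp: acute_val_def)
  moreover have "m dvd n \<longleftrightarrow> (\<forall>p. prime p \<longrightarrow> multiplicity p m \<le> multiplicity p n)"
    using assms by (auto intro: dvd_imp_multiplicity_le multiplicity_le_imp_dvd)
  ultimately show ?thesis
    by blast
qed

lemma gcd_dvd_iff_acute_power:
  assumes "x > 0" and "n > 0"
  shows "gcd x y dvd n \<longleftrightarrow>
    (\<forall>p. prime p \<longrightarrow> \<not> (p ^ acute_val p n dvd x \<and> p ^ acute_val p n dvd y))"
  using assms dvd_iff_acute_power_not_dvd[of "gcd x y" n] by simp

lemma acute_power_dvd_prime_power:
  fixes p r :: nat
  assumes "prime p" and "prime r" and "p ^ acute_val p n dvd r ^ k"
  shows "p = r"
proof -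
  have "p dvd p ^ acute_val p n"
    by (simp add: acute_val_def)
  then show ?thesis
    using assms by (metis dvd_trans prime_dvd_power primes_dvd_imp_eq)
qed

lemma card_label_neighbours_eq:
  assumes "n > 0" and "a \<in> {1..n}" and "b \<in> {1..n}"
    and same: "\<And>p. prime p \<Longrightarrow> p ^ acute_val p n dvd a \<longleftrightarrow> p ^ acute_val p n dvd b"
  shows "card (label_neighbours n a) = card (label_neighbours n b)"
proof -
  have "gcd a y dvd n \<longleftrightarrow> gcd b y dvd n" for y
    using assms by (auto simp: gcd_dvd_iff_acute_power)
  \<comment> \<open>The sets agree before \<open>a\<close>, respectively \<open>b\<close>, is
    removed. The removals cost equally much, since \<open>a\<close> and \<open>b\<close> are both in
    the common set or both outside it.\<close>
  moreover from this[of a] this[of b] have "gcd b a dvd n \<longleftrightarrow> a dvd n" "a dvd n \<longleftrightarrow> b dvd n"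
    using assms by (auto simp: dvd_iff_acute_power_not_dvd)
  ultimately show ?thesis
    using assms(2,3)
    by (simp add: label_neighbours_def card_Diff_singleton_if gcd.commute[of b a])
qed

lemma card_label_neighbours_less:
  assumes "n > 0" and "a \<in> {1..n}" and "b \<in> {1..n}" and "a dvd b" and "\<not> primepow b"
    and p: "prime p" "\<not> p ^ acute_val p n dvd a" "p ^ acute_val p n dvd b"
  shows "card (label_neighbours n b) < card (label_neighbours n a)"
proof -
  let ?M = "\<lambda>x. {y \<in> {1..n}. gcd x y dvd n}"
  let ?q = "p ^ acute_val p n"
  have q: "?q \<in> {1..n}"
    using p(1,3) assms(3) prime_gt_0_nat[OF p(1)] dvd_imp_le[OF p(3)] by simp
  have "primepow ?q"
    using p(1) by (subst primepow_prime_power) (auto simp: acute_val_def)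
  then have "?q \<noteq> b"
    using assms(5) by metis
  have M_iff: "gcd x y dvd n \<longleftrightarrow>
      (\<forall>r. prime r \<longrightarrow> \<not> (r ^ acute_val r n dvd x \<and> r ^ acute_val r n dvd y))"
    if "x \<in> {1..n}" for x y
    using that \<open>n > 0\<close> by (simp add: gcd_dvd_iff_acute_power)
  have sub: "?M b \<subseteq> ?M a"
    using gcd_mono[OF \<open>a dvd b\<close> dvd_refl] by (blast intro: dvd_trans)
  \<comment> \<open>The only prime whose critical power can divide \<open>?q\<close> is
    \<open>p\<close>, and for \<open>p\<close> that power does not divide \<open>a\<close>.\<close>
  have "?q \<in> ?M a"
    using acute_power_dvd_prime_power[OF _ p(1)] p q assms(2) by (auto simp: M_iff)
  have "?q \<notin> ?M b"
    using p assms(3) by (auto simp: M_iff)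
  have "b \<notin> ?M b"
    using p assms(3) by (auto simp: M_iff)
  then have nb: "label_neighbours n b = ?M b"
    by (simp add: label_neighbours_def)
  \<comment> \<open>If \<open>a dvd n\<close>, then \<open>a\<close> is removed from
    \<open>?M a\<close>, so strictness needs two elements of \<open>?M a\<close> outside
    \<open>?M b\<close>: \<open>?q\<close> and \<open>b\<close>. Otherwise nothing is removed and
    \<open>?q\<close> suffices.\<close>
  show ?thesis
  proof (cases "a dvd n")
    case True
    have "b \<in> ?M a"
      using dvd_trans[OF gcd_dvd1 True] assms(3) by simp
    then have "insert b (?M b) \<subset> ?M a"
      using sub \<open>?q \<in> ?M a\<close> \<open>?q \<notin> ?M b\<close> \<open>?q \<noteq> b\<close> by blast
    then have "card (insert b (?M b)) < card (?M a)"
      by (intro psubset_card_mono) auto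
    then have "Suc (card (?M b)) < card (?M a)"
      using \<open>b \<notin> ?M b\<close> by (subst (asm) card_insert_disjoint) auto
    then show ?thesis
      unfolding nb by (auto simp: label_neighbours_def card_Diff_singleton_if)
  next
    case False
    then have "label_neighbours n a = ?M a"
      by (simp add: label_neighbours_def)
    moreover have "?M b \<subset> ?M a"
      using sub \<open>?q \<in> ?M a\<close> \<open>?q \<notin> ?M b\<close> by blast
    ultimately show ?thesis
      unfolding nb by (simp add: psubset_card_mono)
  qed
qed

theorem theorem4p5:
  fixes G :: "'a pair_pre_digraph" and f :: "'a \<Rightarrow> nat" and n t :: nat and u v :: 'a
  assumes "n > 0"
    and "maximal_diophantine_graph G"
    and "card (pverts G) = n"
    and "diophantine_labelling G f"
    and "u \<in> pverts G" and "v \<in> pverts G"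
    and "t > 0" and "f v = t * f u"
    and "\<not> primepow (f v)"
  shows "vertex_degree G u = vertex_degree G v \<longleftrightarrow>
    (\<forall>p. prime p \<and> p dvd t \<longrightarrow>
       (acute_val p n \<le> multiplicity p (f u) \<and> \<not> acute_val p n > multiplicity p (f v)) \<or>
       (\<not> acute_val p n \<le> multiplicity p (f u) \<and> acute_val p n > multiplicity p (f v)))"
proof -
  let ?a = "f u" and ?b = "f v"
  have "f ` pverts G = {1..n}"
    using assms(3,4) by (auto simp: diophantine_labelling_def bij_betw_def)
  then have a: "?a \<in> {1..n}" and b: "?b \<in> {1..n}"
    using assms(5,6) by blast+
  have deg: "vertex_degree G u = card (label_neighbours n ?a)"
    "vertex_degree G v = card (label_neighbours n ?b)"
    using vertex_degree_eq_card_label_neighbours[OF assms(2,4)] assms(3,5,6) by auto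
  have "?a dvd ?b"
    using assms(8) by simp
  have le_iff: "acute_val p n \<le> multiplicity p x \<longleftrightarrow> p ^ acute_val p n dvd x"
    if "prime p" "x \<in> {1..n}" for p x
    using that by (subst power_dvd_iff_le_multiplicity) auto
  let ?same = "\<lambda>p. p ^ acute_val p n dvd ?a \<longleftrightarrow> p ^ acute_val p n dvd ?b"
  \<comment> \<open>Primes not dividing \<open>t\<close> have equal valuations in both labels, so
    only those dividing \<open>t\<close> can separate them.\<close>
  have not_dvd: "?same p" if "prime p" "\<not> p dvd t" for p
  proof -
    have "coprime (p ^ acute_val p n) t"
      using that by (simp add: prime_imp_coprime)
    then show ?thesis
      using assms(8) by (simp add: coprime_dvd_mult_right_iff)
  qed
  have "vertex_degree G u = vertex_degree G v \<longleftrightarrow> (\<forall>p. prime p \<longrightarrow> ?same p)"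
  proof
    assume "vertex_degree G u = vertex_degree G v"
    then show "\<forall>p. prime p \<longrightarrow> ?same p"
      using card_label_neighbours_less[OF assms(1) a b \<open>?a dvd ?b\<close> assms(9)] \<open>?a dvd ?b\<close>
      by (metis deg dvd_trans less_irrefl)
  next
    assume "\<forall>p. prime p \<longrightarrow> ?same p"
    then show "vertex_degree G u = vertex_degree G v"
      using card_label_neighbours_eq[OF assms(1) a b] deg by simp
  qed
  also have "\<dots> \<longleftrightarrow> (\<forall>p. prime p \<and> p dvd t \<longrightarrow> ?same p)"
    using not_dvd by blast
  \<comment> \<open>By \<open>le_iff\<close>, the exclusive disjunction at \<open>p\<close> is
    exactly \<open>?same p\<close>.\<close>
  finally show ?thesis
    using le_iff[OF _ a] le_iff[OF _ b] by (auto simp flip: not_le)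
qed

end
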